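(* Let $H$ be a real Hilbert space, $\mu_F\in\mathbb{R}$, and let $F:H\to 2^H$ be a $\mu_F$-monotone operator. Then $F$ is maximal $\mu_F$-monotone if and only if the following holds: for all $x,u\in H$, if $$\langle u-v,x-y\rangle\ge\mu_F\|x-y\|^2\quad\text{for all } y\in H \text{ and } v\in F(y),$$ then $u\in F(x)$.
   Context: For $\mu\in\mathbb{R}$ (possibly negative), an operator $F:H\to 2^H$ is $\mu$-monotone if $\langle x-y,u-v\rangle\ge\mu\|x-y\|^2$ for all $x,y\in H$, $u\in F(x)$, $v\in F(y)$. A $\mu$-monotone operator is maximal $\mu$-monotone if there is no $\mu$-monotone operator whose graph strictly contains its graph, where the graph of $F$ is $\{(x,u)\in H\times H: u\in F(x)\}$. *)

theory Defs
  imports "HOL-Analysis.Analysis"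
begin

definition operator_graph :: "('a \<Rightarrow> 'a set) \<Rightarrow> ('a \<times> 'a) set" where
  "operator_graph F = {(x, u). u \<in> F x}"

definition mu_monotone :: "real \<Rightarrow> ('a::real_inner \<Rightarrow> 'a set) \<Rightarrow> bool" where
  "mu_monotone \<mu> F \<longleftrightarrow>
     (\<forall>x y. \<forall>u \<in> F x. \<forall>v \<in> F y. (x - y) \<bullet> (u - v) \<ge> \<mu> * (norm (x - y))\<^sup>2)"

definition maximal_mu_monotone :: "real \<Rightarrow> ('a::real_inner \<Rightarrow> 'a set) \<Rightarrow> bool" where
  "maximal_mu_monotone \<mu> F \<longleftrightarrow>
     mu_monotone \<mu> F \<and> (\<nexists>G. mu_monotone \<mu> G \<and> operator_graph F \<subset> operator_graph G)"

end

theory Submission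
  imports Defs
begin

text \<open>The inequality on the right says that \<open>(x, u)\<close> is monotonically related to
  every point of the graph of \<open>F\<close>. Such a point can be added to the graph without
  losing monotonicity (\<open>mu_monotone_fun_upd_insert\<close>), so maximality forces it to be
  there already. Conversely, any point of a monotone extension \<open>G\<close> is related to all of
  the graph of \<open>F\<close>, so the condition puts it back into \<open>F\<close> and no
  extension is strict.\<close>

lemma operator_graph_fun_upd_insert:
  "operator_graph (F(x := insert u (F x))) = insert (x, u) (operator_graph F)"
  by (auto simp: operator_graph_def split: if_splits)

lemma mu_monotone_iff_graph:
  "mu_monotone \<mu> F \<longleftrightarrow>
    (\<forall>(x, u) \<in> operator_graph F. \<forall>(y, v) \<in> operator_graph F.
      (u - v) \<bullet> (x - y) \<ge> \<mu> * (norm (x - y))\<^sup>2)"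
  by (auto simp: mu_monotone_def operator_graph_def inner_commute)

lemma inner_diff_swap:
  fixes x y u v :: "'a::real_inner"
  shows "(v - u) \<bullet> (y - x) = (u - v) \<bullet> (x - y)"
  by (simp add: inner_diff_left inner_diff_right)

text \<open>Only pairs involving the new point \<open>(x, u)\<close> need checking: against old
  points the second assumption applies, and against itself both sides are 0.\<close>

lemma mu_monotone_fun_upd_insert:
  assumes "mu_monotone \<mu> F"
    and "\<And>y v. v \<in> F y \<Longrightarrow> (u - v) \<bullet> (x - y) \<ge> \<mu> * (norm (x - y))\<^sup>2"
  shows "mu_monotone \<mu> (F(x := insert u (F x)))"
proof -
  \<comment> \<open>Monotonicity ranges over ordered pairs, so the new point must also be allowed in
    second position.\<close>
  have "(v - u) \<bullet> (y - x) \<ge> \<mu> * (norm (y - x))\<^sup>2" if "v \<in> F y" for y v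
    using assms(2)[OF that] by (simp only: inner_diff_swap[of v u] norm_minus_commute[of y])
  then show ?thesis
    using assms unfolding mu_monotone_iff_graph operator_graph_fun_upd_insert
    by (auto simp: operator_graph_def)
qed

theorem lemma2p7:
  fixes F :: "'a::{real_inner, complete_space} \<Rightarrow> 'a set" and \<mu>\<^sub>F :: real
  assumes "mu_monotone \<mu>\<^sub>F F"
  shows "maximal_mu_monotone \<mu>\<^sub>F F \<longleftrightarrow>
    (\<forall>x u. (\<forall>y. \<forall>v \<in> F y. (u - v) \<bullet> (x - y) \<ge> \<mu>\<^sub>F * (norm (x - y))\<^sup>2) \<longrightarrow> u \<in> F x)"
    (is "_ \<longleftrightarrow> ?R")
proof
  assume max: "maximal_mu_monotone \<mu>\<^sub>F F"
  show ?R
  proof (intro allI impI)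
    fix x u
    assume "\<forall>y. \<forall>v \<in> F y. (u - v) \<bullet> (x - y) \<ge> \<mu>\<^sub>F * (norm (x - y))\<^sup>2"
    then have "mu_monotone \<mu>\<^sub>F (F(x := insert u (F x)))"
      using assms by (intro mu_monotone_fun_upd_insert) auto
    \<comment> \<open>The enlarged operator is a competitor in the definition of maximality; the
      inclusion always holds, so only its strictness can fail.\<close>
    then have "\<not> operator_graph F \<subset> insert (x, u) (operator_graph F)"
      using max unfolding maximal_mu_monotone_def
      by (metis operator_graph_fun_upd_insert)
    then have "(x, u) \<in> operator_graph F"
      by blast
    then show "u \<in> F x"
      by (simp add: operator_graph_def)
  qed
next
  assume R: ?R
  have "\<not> operator_graph F \<subset> operator_graph G" if G: "mu_monotone \<mu>\<^sub>F G" for G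
  proof
    assume FG: "operator_graph F \<subset> operator_graph G"
    then obtain x u where xu: "(x, u) \<in> operator_graph G" "(x, u) \<notin> operator_graph F"
      by auto
    \<comment> \<open>Both points lie in the graph of \<open>G\<close>, whose monotonicity relates
      them.\<close>
    have "(u - v) \<bullet> (x - y) \<ge> \<mu>\<^sub>F * (norm (x - y))\<^sup>2" if "v \<in> F y" for y v
    proof -
      have "(y, v) \<in> operator_graph G"
        using that FG by (auto simp: operator_graph_def)
      then show ?thesis
        using G xu(1) by (auto simp: mu_monotone_iff_graph)
    qed
    then have "u \<in> F x"
      using R by blast
    then show False
      using xu(2) by (simp add: operator_graph_def)
  qed
  then show "maximal_mu_monotone \<mu>\<^sub>F F"
    using assms by (auto simp: maximal_mu_monotone_def)
qed

end
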